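(* Let $(a(t))_{t\ge 0}$ be the sequence defined by $$a(t)=\begin{cases}3,&\text{if } t=1;\\ 2,&\text{if } t=0,2;\\ a(n),&\text{if } t=a(1)+\cdots+a(n);\\ 2,&\text{if } a(t-1)=3\text{ and there is no } n\ge 0 \text{ with } t=a(1)+\cdots+a(n);\\ 3,&\text{if } a(t-1)=2\text{ and there is no } n\ge 0\text{ with } t=a(1)+\cdots+a(n),\end{cases}$$ where the last three cases apply to $t\ge 3$. For $n\ge 0$ let $A(n)$ be the number of integers $k\ge 0$ such that $\lfloor k(\sqrt2-1)\rfloor=n$. Then $a(n)=A(n+1)$ for all $n\ge 0$.
   Context: $a(n)$ is OEIS sequence A082844 and $A(n)$ is OEIS sequence A097509. *)

theory Defs
  imports Complex_Main
begin

definition is_seq_a :: "(nat \<Rightarrow> nat) \<Rightarrow> bool" where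
  "is_seq_a a \<longleftrightarrow>
     a 1 = 3 \<and> a 0 = 2 \<and> a 2 = 2 \<and>
     (\<forall>t\<ge>3.
        (\<forall>n. t = (\<Sum>i=1..n. a i) \<longrightarrow> a t = a n) \<and>
        (a (t - 1) = 3 \<and> (\<nexists>n. t = (\<Sum>i=1..n. a i)) \<longrightarrow> a t = 2) \<and>
        (a (t - 1) = 2 \<and> (\<nexists>n. t = (\<Sum>i=1..n. a i)) \<longrightarrow> a t = 3))"

lemma sum_lower:
  fixes f :: "nat \<Rightarrow> nat"
  assumes "\<And>i. i < t \<Longrightarrow> f i \<ge> 2" "n < t"
  shows "2 * n \<le> (\<Sum>i=1..n. f i)"
proof -
  have "(\<Sum>i=1..n. 2) \<le> (\<Sum>i=1..n. f i)"
    using assms by (intro sum_mono) auto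
  then show ?thesis by simp
qed

lemma sum_index_less:
  fixes f :: "nat \<Rightarrow> nat"
  assumes ge: "\<And>i. i < t \<Longrightarrow> f i \<ge> 2" and t: "t \<ge> 3" and eq: "t = (\<Sum>i=1..n. f i)"
  shows "n < t"
proof (rule ccontr)
  assume "\<not> n < t"
  then have "(\<Sum>i=1..t-1. f i) \<le> (\<Sum>i=1..n. f i)"
    by (intro sum_mono2) auto
  moreover have "2 * (t - 1) \<le> (\<Sum>i=1..t-1. f i)"
    by (rule sum_lower[of t]) (use ge t in auto)
  ultimately show False using eq t by linarith
qed

lemma is_seq_a_values:
  assumes "is_seq_a f"
  shows "f t \<in> {2, 3}"
proof (induction t rule: less_induct)
  case (less t)
  note f = assms[unfolded is_seq_a_def]
  show ?case
  proof (cases "t \<ge> 3")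
    case False
    then have "t = 0 \<or> t = 1 \<or> t = 2" by auto
    then show ?thesis using f by auto
  next
    case t: True
    have ge: "f i \<ge> 2" if "i < t" for i using less[OF that] by auto
    show ?thesis
    proof (cases "\<exists>n. t = (\<Sum>i=1..n. f i)")
      case True
      then obtain n where n: "t = (\<Sum>i=1..n. f i)" by blast
      have "n < t" using sum_index_less[OF ge t n] by simp
      moreover have "f t = f n" using f t n by blast
      ultimately show ?thesis using less[of n] by simp
    next
      case False
      have "f (t - 1) \<in> {2, 3}" using less[of "t - 1"] t by simp
      then show ?thesis using f t False by auto
    qed
  qed
qed

lemma is_seq_a_unique:
  assumes f: "is_seq_a f" and g: "is_seq_a g"
  shows "f t = g t"
proof (induction t rule: less_induct)
  case (less t)
  note f' = f[unfolded is_seq_a_def] and g' = g[unfolded is_seq_a_def]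
  show ?case
  proof (cases "t \<ge> 3")
    case False
    then have "t = 0 \<or> t = 1 \<or> t = 2" by auto
    then show ?thesis using f' g' by auto
  next
    case t: True
    have gef: "f i \<ge> 2" for i using is_seq_a_values[OF f, of i] by auto
    have geg: "g i \<ge> 2" for i using is_seq_a_values[OF g, of i] by auto
    have sums: "(\<Sum>i=1..n. f i) = (\<Sum>i=1..n. g i)" if "n < t" for n
      using that less by (intro sum.cong) auto
    have iff: "t = (\<Sum>i=1..n. f i) \<longleftrightarrow> t = (\<Sum>i=1..n. g i)" for n
      using sum_index_less[of t f n] sum_index_less[of t g n] gef geg t sums[of n] by metis
    show ?thesis
    proof (cases "\<exists>n. t = (\<Sum>i=1..n. f i)")
      case True
      then obtain n where n: "t = (\<Sum>i=1..n. f i)" by blast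
      have "n < t" using sum_index_less[OF gef t n] by simp
      moreover have "f t = f n" using f' t n by blast
      moreover have "g t = g n" using g' t n iff by blast
      ultimately show ?thesis using less[of n] by simp
    next
      case no: False
      then have no': "\<nexists>n. t = (\<Sum>i=1..n. g i)" using iff by blast
      have "f (t - 1) = g (t - 1)" using less[of "t - 1"] t by simp
      moreover have "f (t - 1) \<in> {2, 3}" by (rule is_seq_a_values[OF f])
      ultimately show ?thesis using f' g' t no no' by auto
    qed
  qed
qed

lemma is_seq_a_exists: "\<exists>f. is_seq_a f"
proof -
  define H :: "(nat \<Rightarrow> nat) \<Rightarrow> nat \<Rightarrow> nat" where
    "H = (\<lambda>g t. if t = 1 then 3 else if t = 0 \<or> t = 2 then 2
       else if \<exists>n<t. t = (\<Sum>i=1..n. g i) then g (SOME n. n < t \<and> t = (\<Sum>i=1..n. g i))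
       else if g (t - 1) = 3 then 2 else 3)"
  define f where "f = wfrec less_than H"
  have unf: "f t = H (cut f less_than t) t" for t
    unfolding f_def by (rule wfrec) simp
  have cut: "cut f less_than t i = f i" if "i < t" for t i
    using that by (simp add: cut_def)
  have cut_sum: "(\<Sum>i=1..n. cut f less_than t i) = (\<Sum>i=1..n. f i)" if "n < t" for t n
    using that by (intro sum.cong) (auto simp: cut)
  have small: "f 1 = 3" "f 0 = 2" "f 2 = 2"
    unfolding unf[of 1] unf[of 0] unf[of 2] H_def by simp_all
  have hit: "\<exists>n<t. t = (\<Sum>i=1..n. f i) \<and> f t = f n"
    if t: "t \<ge> 3" and ex: "\<exists>n<t. t = (\<Sum>i=1..n. f i)" for t
  proof -
    define n where "n = (SOME n. n < t \<and> t = (\<Sum>i=1..n. cut f less_than t i))"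
    have ex': "\<exists>n. n < t \<and> t = (\<Sum>i=1..n. cut f less_than t i)"
      using ex cut_sum by metis
    from someI_ex[OF this] have n: "n < t" "t = (\<Sum>i=1..n. cut f less_than t i)"
      unfolding n_def by blast+
    have "f t = cut f less_than t n"
      using t ex' unfolding unf[of t] H_def n_def by simp
    then show ?thesis using n cut cut_sum by auto
  qed
  have miss: "f t = (if f (t - 1) = 3 then 2 else 3)"
    if t: "t \<ge> 3" and nex: "\<not> (\<exists>n<t. t = (\<Sum>i=1..n. f i))" for t
  proof -
    have nex': "\<not> (\<exists>n<t. t = (\<Sum>i=1..n. cut f less_than t i))"
      using nex cut_sum by metis
    have "f t = (if cut f less_than t (t - 1) = 3 then 2 else 3)"
      using t nex' unfolding unf[of t] H_def if_not_P[OF nex'] by simp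
    then show ?thesis using cut[of "t - 1" t] t by simp
  qed
  have ge: "f t \<ge> 2" for t
  proof (induction t rule: less_induct)
    case (less t)
    show ?case
    proof (cases "t \<ge> 3")
      case False
      then have "t = 0 \<or> t = 1 \<or> t = 2" by auto
      then show ?thesis using small by auto
    next
      case True
      show ?thesis
        using hit[OF True] miss[OF True] less
        by (cases "\<exists>n<t. t = (\<Sum>i=1..n. f i)") force+
    qed
  qed
  have mono: "(\<Sum>i=1..m. f i) < (\<Sum>i=1..n. f i)" if "m < n" for m n
  proof (rule sum_strict_mono2)
    show "n \<in> {1..n} - {1..m}" using that by auto
    show "0 < f n" using ge[of n] by simp
  qed (use that in auto)
  have uniq: "m = n" if "(\<Sum>i=1..m. f i) = (\<Sum>i=1..n. f i)" for m n
    using mono[of m n] mono[of n m] that by (cases m n rule: linorder_cases) auto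
  have "is_seq_a f"
    unfolding is_seq_a_def
  proof (intro conjI allI impI)
    fix t n assume t: "3 \<le> t" and n: "t = (\<Sum>i=1..n. f i)"
    have "n < t" using sum_index_less[OF ge t n] .
    then obtain m where m: "t = (\<Sum>i=1..m. f i)" "f t = f m" using hit[OF t] n by blast
    have "m = n" using uniq m(1) n by metis
    then show "f t = f n" using m(2) by simp
  next
    fix t assume t: "3 \<le> t" and "f (t - 1) = 3 \<and> (\<nexists>n. t = (\<Sum>i=1..n. f i))"
    then show "f t = 2" using miss[OF t] by auto
  next
    fix t assume t: "3 \<le> t" and "f (t - 1) = 2 \<and> (\<nexists>n. t = (\<Sum>i=1..n. f i))"
    then show "f t = 3" using miss[OF t] by auto
  qed (use small in auto)
  then show ?thesis by blast
qed

lemma is_seq_a_ex1: "\<exists>!a. is_seq_a a"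
  using is_seq_a_exists is_seq_a_unique by blast

definition seq_a :: "nat \<Rightarrow> nat" where
  "seq_a = (THE a. is_seq_a a)"

lemma seq_a: "is_seq_a seq_a"
  unfolding seq_a_def by (rule theI'[OF is_seq_a_ex1])

definition seq_A :: "nat \<Rightarrow> nat" where
  "seq_A n = card {k :: nat. \<lfloor>real k * (sqrt 2 - 1)\<rfloor> = int n}"

(* card is 0 on infinite sets; this lemma excludes that case for seq_A. *)
lemma seq_A_finite: "finite {k :: nat. \<lfloor>real k * (sqrt 2 - 1)\<rfloor> = int n}"
proof -
  define c where "c = sqrt 2 - (1 :: real)"
  have c: "c > 0" by (simp add: c_def)
  have "k \<le> nat \<lceil>(real n + 1) / c\<rceil>" if "\<lfloor>real k * c\<rfloor> = int n" for k :: nat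
  proof -
    have "real k * c < real n + 1" using that by linarith
    then have "real k < (real n + 1) / c" using c by (simp add: field_simps)
    then show ?thesis by linarith
  qed
  then have "{k :: nat. \<lfloor>real k * c\<rfloor> = int n} \<subseteq> {..nat \<lceil>(real n + 1) / c\<rceil>}" by auto
  then show ?thesis unfolding c_def by (rule finite_subset) simp
qed

end

theory Submission imports Defs "HOL-Computational_Algebra.Primes" begin

text \<open>
  With \<open>\<theta> = sqrt 2 - 1\<close>, so that \<open>1 / \<theta> = 2 + \<theta>\<close>, the integers \<open>k\<close> counted by \<open>A (n + 1)\<close> lie
  between \<open>(n + 1) / \<theta>\<close> and \<open>(n + 2) / \<theta>\<close>; by irrationality their number is
  \<open>b n = 2 + \<lfloor>(n + 2) \<theta>\<rfloor> - \<lfloor>(n + 1) \<theta>\<rfloor>\<close>. The partial sums of \<open>b\<close> telescope to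
  \<open>\<lfloor>(n + 2) / \<theta>\<rfloor> - 4\<close>. If \<open>t + 4 = \<lfloor>N / \<theta>\<rfloor>\<close>, then \<open>(t + 4) \<theta> = N - \<epsilon> \<theta>\<close>, where \<open>\<epsilon>\<close> is the
  fractional part of \<open>N \<theta>\<close>, and both \<open>b t = 3\<close> and \<open>b (N - 2) = 3\<close> amount to \<open>\<epsilon> < \<theta>\<close>. If \<open>t + 4\<close>
  is not of this form, then \<open>\<lfloor>(t + 4) \<theta>\<rfloor> = \<lfloor>(t + 5) \<theta>\<rfloor>\<close>, which is incompatible with
  \<open>b (t - 1) = b t = 2\<close>; and \<open>b (t - 1) = b t = 3\<close> never happens because \<open>2 \<theta> < 1\<close>.
  Hence \<open>b\<close> satisfies the recursion defining \<open>a\<close>.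
\<close>

definition theta :: real where
  "theta = sqrt 2 - 1"

definition fl :: "nat \<Rightarrow> int" where
  "fl k = \<lfloor>real k * theta\<rfloor>"

text \<open>\<open>nat\<close> truncates nothing here, since \<open>fl\<close> is
  nondecreasing.\<close>

definition seq_b :: "nat \<Rightarrow> nat" where
  "seq_b n = nat (2 + fl (n + 2) - fl (n + 1))"

lemma theta_sq: "theta * theta = 1 - 2 * theta"
  by (simp add: theta_def algebra_simps)

lemma theta_bounds: "2 / 5 < theta" "theta < 3 / 7"
proof -
  have "7 / 5 < sqrt 2" by (rule real_less_rsqrt) (simp add: power2_eq_square)
  moreover have "sqrt 2 < 10 / 7" by (rule real_less_lsqrt) (simp_all add: power2_eq_square)
  ultimately show "2 / 5 < theta" "theta < 3 / 7" by (simp_all add: theta_def)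
qed

text \<open>Otherwise \<open>2 * k^2 = (m + k)^2\<close>, where the prime 2 has odd multiplicity on
  the left and even on the right.\<close>

lemma theta_irrational:
  assumes "k > 0"
  shows "real k * theta \<noteq> of_int m"
proof
  assume "real k * theta = of_int m"
  then have "sqrt 2 * real k = of_int (m + int k)"
    by (simp add: theta_def algebra_simps)
  then have "(sqrt 2 * real k)\<^sup>2 = (of_int (m + int k))\<^sup>2" by simp
  then have "of_int (2 * (int k)\<^sup>2) = (of_int ((m + int k)\<^sup>2) :: real)"
    by (simp add: power_mult_distrib)
  then have eq: "2 * (int k)\<^sup>2 = (m + int k)\<^sup>2" unfolding of_int_eq_iff .
  with assms have "m + int k \<noteq> 0" by auto
  with assms have "multiplicity 2 (2 * (int k)\<^sup>2) = Suc (2 * multiplicity 2 (int k))"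
    "multiplicity 2 ((m + int k)\<^sup>2) = 2 * multiplicity 2 (m + int k)"
    by (simp_all add: prime_elem_multiplicity_mult_distrib prime_elem_multiplicity_power_distrib)
  then show False using eq by (metis even_Suc dvd_triv_left)
qed

lemma fl_le: "of_int (fl k) \<le> real k * theta"
  and less_fl: "real k * theta < of_int (fl k) + 1"
  by (simp_all add: fl_def)

lemma fl_eq: "of_int m \<le> real k * theta \<Longrightarrow> real k * theta < of_int m + 1 \<Longrightarrow> fl k = m"
  unfolding fl_def by (rule floor_unique)

lemma fl_nonneg: "0 \<le> fl k"
  using theta_bounds by (simp add: fl_def)

lemma fl_Suc_cases: "fl (Suc k) = fl k \<or> fl (Suc k) = fl k + 1"
proof -
  have *: "real (Suc k) * theta = real k * theta + theta" by (simp add: algebra_simps)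
  have "of_int (fl (Suc k)) < (of_int (fl k + 2) :: real)"
    "of_int (fl k) < (of_int (fl (Suc k) + 1) :: real)"
    using fl_le[of "Suc k"] less_fl[of "Suc k"] fl_le[of k] less_fl[of k] theta_bounds
    unfolding * of_int_add by auto
  then show ?thesis unfolding of_int_less_iff by linarith
qed

lemma int_seq_b: "int (seq_b n) = 2 + fl (n + 2) - fl (n + 1)"
  using fl_Suc_cases[of "n + 1"] by (auto simp: seq_b_def)

lemma seq_b_cases: "seq_b n = 2 \<or> seq_b n = 3"
  using fl_Suc_cases[of "n + 1"] int_seq_b[of n] by auto

text \<open>Here \<open>2 * m + fl m\<close> is the integer part of \<open>m / \<theta>\<close>.\<close>

lemma fl_less_iff:
  assumes "m > 0"
  shows "fl k < int m \<longleftrightarrow> int k \<le> 2 * int m + fl m"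
proof -
  have "fl k < int m \<longleftrightarrow> real k * theta < real m"
    by (simp add: fl_def floor_less_iff)
  also have "(2 + theta) * theta = 1" using theta_sq by (simp add: algebra_simps)
  then have "real m = real m * (2 + theta) * theta" by (simp add: mult.assoc)
  also have "real k * theta < \<dots> \<longleftrightarrow> real k < real m * (2 + theta)"
    using theta_bounds by (intro mult_less_cancel_right_pos) simp
  also have "\<dots> \<longleftrightarrow> of_int (int k - 2 * int m) < real m * theta"
    by (simp add: algebra_simps)
  \<comment> \<open>For \<open>m > 0\<close> the number \<open>real m * theta\<close> is not an
    integer, so \<open><\<close> and \<open>\<le>\<close> agree.\<close>
  also have "\<dots> \<longleftrightarrow> int k - 2 * int m \<le> fl m"
    using theta_irrational[OF assms, of "int k - 2 * int m"]
    unfolding fl_def le_floor_iff by linarith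
  finally show ?thesis by linarith
qed

lemma seq_A_eq_seq_b: "seq_A (n + 1) = seq_b n"
proof -
  define g where "g m = nat (2 * int m + fl m)" for m
  have g: "int (g m) = 2 * int m + fl m" for m
    using fl_nonneg[of m] by (simp add: g_def)
  \<comment> \<open>At \<open>m = 0\<close> this fails: \<open>k = 0\<close> satisfies only the
    right side. Hence the shift to \<open>n + 1\<close>.\<close>
  have le_g: "fl k < int m \<longleftrightarrow> k \<le> g m" if "m > 0" for k m
    unfolding fl_less_iff[OF that] g[symmetric] by simp
  have "fl k = int (n + 1) \<longleftrightarrow> \<not> fl k < int (n + 1) \<and> fl k < int (n + 2)" for k
    by linarith
  then have "fl k = int (n + 1) \<longleftrightarrow> g (n + 1) < k \<and> k \<le> g (n + 2)" for k
    using le_g[of "n + 1" k] le_g[of "n + 2" k]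
    by (metis add_gr_0 not_le zero_less_numeral zero_less_one)
  then have "{k. fl k = int (n + 1)} = {g (n + 1)<..g (n + 2)}"
    by (intro set_eqI) (simp only: mem_Collect_eq greaterThanAtMost_iff)
  then have "seq_A (n + 1) = g (n + 2) - g (n + 1)"
    by (simp only: seq_A_def fl_def theta_def card_greaterThanAtMost)
  also have "int (g (n + 2)) = int (g (n + 1) + seq_b n)"
    unfolding of_nat_add g int_seq_b by simp
  then have "g (n + 2) - g (n + 1) = seq_b n" by linarith
  finally show ?thesis .
qed

lemma fl_small: "fl 1 = 0" "fl 2 = 0" "fl 3 = 1" "fl 4 = 1"
  using theta_bounds by (auto intro!: fl_eq)

lemma sum_seq_b: "int (\<Sum>i=1..n. seq_b i) = 2 * int n + fl (n + 2)"
proof (induction n)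
  case 0
  then show ?case using fl_small by (simp add: numeral_2_eq_2)
next
  case (Suc n)
  then show ?case using int_seq_b[of "Suc n"] by simp
qed

lemma seq_b_hit:
  assumes t: "t = (\<Sum>i=1..n. seq_b i)"
  shows "seq_b t = seq_b n"
proof -
  define N where "N = n + 2"
  define e where "e = real N * theta - of_int (fl N)"
  have e: "0 \<le> e" "e < 1" using fl_le[of N] less_fl[of N] by (simp_all add: e_def)
  have "int t + 4 = 2 * int N + fl N"
    using sum_seq_b[of n] t by (simp add: N_def)
  then have "real t + 4 = 2 * real N + of_int (fl N)"
    by (metis of_int_add of_int_mult of_int_numeral of_int_of_nat_eq)
  then have rt: "real t = real N * (2 + theta) - e - 4"
    by (simp add: e_def algebra_simps)
  have "real t * theta = real N * ((2 + theta) * theta) - e * theta - 4 * theta"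
    unfolding rt by (simp add: algebra_simps)
  also have "(2 + theta) * theta = 1" using theta_sq by (simp add: algebra_simps)
  finally have t0: "real t * theta = real N - e * theta - 4 * theta" by simp
  define y where "y = e * theta"
  have t1: "real (t + 1) * theta = real N - y - 3 * theta"
    and t2: "real (t + 2) * theta = real N - y - 2 * theta"
    using t0 by (simp_all add: y_def algebra_simps)
  have y: "0 \<le> y" "y < theta"
    using e theta_bounds by (simp_all add: y_def)
  have f1: "fl (t + 1) = int N - 2"
    by (rule fl_eq; unfold t1) (use y theta_bounds in simp_all)
  have n1: "real (n + 1) * theta = of_int (fl N) + e - theta"
    by (simp add: e_def N_def algebra_simps)
  show ?thesis
  \<comment> \<open>This decides whether an integer lies in the step from \<open>n + 1\<close> to
    \<open>N\<close>, and also, since \<open>theta * theta = 1 - 2 * theta\<close>, whether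
    \<open>N - y - 2 * theta\<close> exceeds \<open>N - 1\<close>.\<close>
  proof (cases "e < theta")
    case True
    then have "y < 1 - 2 * theta"
      unfolding y_def using theta_bounds mult_strict_right_mono[of e theta theta] theta_sq by simp
    then have "fl (t + 2) = int N - 1"
      by (intro fl_eq; unfold t2) (use y theta_bounds in simp_all)
    moreover have "fl (n + 1) = fl N - 1"
      by (rule fl_eq; unfold n1) (use e True theta_bounds in simp_all)
    ultimately show ?thesis using f1 int_seq_b[of t] int_seq_b[of n] by (simp add: N_def)
  next
    case False
    then have "e \<noteq> theta"
      using n1 theta_irrational[of "n + 1" "fl N"] by auto
    with False have e': "theta < e" by simp
    then have "1 - 2 * theta < y"
      unfolding y_def using theta_bounds mult_strict_right_mono[of theta e theta] theta_sq by simp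
    then have "fl (t + 2) = int N - 2"
      by (intro fl_eq; unfold t2) (use y theta_bounds in simp_all)
    moreover have "fl (n + 1) = fl N"
      by (rule fl_eq; unfold n1) (use e e' theta_bounds in simp_all)
    ultimately show ?thesis using f1 int_seq_b[of t] int_seq_b[of n] by (simp add: N_def)
  qed
qed

text \<open>A jump of \<open>fl\<close> to \<open>N\<close> at \<open>t + 5\<close> makes
  \<open>t + 4\<close> the largest \<open>k\<close> with \<open>fl k < N\<close>, that is
  \<open>2 * N + fl N\<close>; then \<open>t\<close> is the partial sum up to
  \<open>N - 2\<close>.\<close>

lemma fl_eq_of_not_hit:
  assumes "t \<ge> 3" and no: "\<nexists>n. t = (\<Sum>i=1..n. seq_b i)"
  shows "fl (t + 5) = fl (t + 4)"
proof (rule ccontr)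
  assume "fl (t + 5) \<noteq> fl (t + 4)"
  then have s: "fl (t + 5) = fl (t + 4) + 1"
    using fl_Suc_cases[of "t + 4"] by (auto simp: eval_nat_numeral)
  define N where "N = nat (fl (t + 5))"
  have N: "int N = fl (t + 5)" using fl_nonneg[of "t + 5"] by (simp add: N_def)
  \<comment> \<open>Needed for \<open>N \<ge> 2\<close>, so that the index \<open>N - 2\<close> is
    not truncated.\<close>
  have "1 < real (t + 4) * theta"
    using assms theta_bounds mult_mono[of 3 "real t" "2 / 5" theta] by (simp add: algebra_simps)
  then have "1 \<le> fl (t + 4)" by (simp add: fl_def le_floor_iff)
  then have N2: "N \<ge> 2" using N s by linarith
  have "int (t + 4) = 2 * int N + fl N"
    using fl_less_iff[of N "t + 4"] fl_less_iff[of N "t + 5"] N s N2 by auto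
  then have "int t = int (\<Sum>i=1..N - 2. seq_b i)"
    unfolding sum_seq_b le_add_diff_inverse2[OF N2] using N2 by (simp add: of_nat_diff)
  then show False using no by (metis of_nat_eq_iff)
qed

lemma seq_b_not_hit:
  assumes "t \<ge> 3" and no: "\<nexists>n. t = (\<Sum>i=1..n. seq_b i)"
  shows "seq_b t \<noteq> seq_b (t - 1)"
proof
  assume eq: "seq_b t = seq_b (t - 1)"
  have b: "int (seq_b (t - 1)) = 2 + fl (t + 1) - fl t"
    using int_seq_b[of "t - 1"] assms by (simp add: numeral_2_eq_2)
  define x where "x = real t * theta"
  have mult: "real (t + k) * theta = x + real k * theta" for k
    by (simp add: x_def algebra_simps)
  note bounds = fl_le[of t] less_fl[of t] fl_le[of "t + 2"] less_fl[of "t + 2"]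
    less_fl[of "t + 4"] fl_le[of "t + 5"] less_fl[of "t + 5"] fl_le[of "t + 4"]
  show False
  proof (cases "seq_b t = 2")
    case True
    then have f: "fl (t + 2) = fl t" using eq b int_seq_b[of t] by simp
    \<comment> \<open>From \<open>x + 2 * theta < fl t + 1\<close> and \<open>2 * theta < 1\<close>
      one gets \<open>x + 4 * theta < fl t + 2\<close>, while \<open>5 * theta > 2\<close> gives
      \<open>x + 5 * theta > fl t + 2\<close>: a forbidden jump.\<close>
    have "of_int (fl (t + 4)) < (of_int (fl t + 2) :: real)"
      "(of_int (fl t + 2) :: real) < of_int (fl (t + 5) + 1)"
      using bounds theta_bounds unfolding mult f x_def[symmetric] by simp_all
    then show False unfolding of_int_less_iff using fl_eq_of_not_hit[OF assms] by linarith
  next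
    case False
    then have f: "fl (t + 2) = fl t + 2" using eq b int_seq_b[of t] seq_b_cases[of t] by simp
    \<comment> \<open>Two consecutive jumps would force \<open>2 * theta > 1\<close>.\<close>
    show False
      using bounds theta_bounds unfolding mult f x_def[symmetric] by simp
  qed
qed

lemma is_seq_a_seq_b: "is_seq_a seq_b"
  unfolding is_seq_a_def
proof (intro conjI allI impI)
  show "seq_b 1 = 3" "seq_b 0 = 2" "seq_b 2 = 2"
    using int_seq_b[of 1] int_seq_b[of 0] int_seq_b[of 2] fl_small
    by (simp_all add: eval_nat_numeral)
next
  fix t n :: nat
  assume "3 \<le> t" "t = (\<Sum>i=1..n. seq_b i)"
  then show "seq_b t = seq_b n" by (intro seq_b_hit)
next
  fix t :: nat
  assume "3 \<le> t" "seq_b (t - 1) = 3 \<and> (\<nexists>n. t = (\<Sum>i=1..n. seq_b i))"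
  then show "seq_b t = 2" using seq_b_not_hit[of t] seq_b_cases[of t] by auto
next
  fix t :: nat
  assume "3 \<le> t" "seq_b (t - 1) = 2 \<and> (\<nexists>n. t = (\<Sum>i=1..n. seq_b i))"
  then show "seq_b t = 3" using seq_b_not_hit[of t] seq_b_cases[of t] by auto
qed

theorem mainTheorem10:
  fixes n :: nat
  shows "seq_a n = seq_A (n + 1)"
  using is_seq_a_unique[OF seq_a is_seq_a_seq_b, of n] seq_A_eq_seq_b[of n] by simp

end
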